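(* Let $m\ge 3$, let $C_1,\ldots,C_m,\mathcal S\subseteq\mathbb R^n$ be nonempty, closed and convex sets, and assume that the collection $\{C_i\}_{i=1}^m$ is in general position with respect to $\mathcal S$. Let $\rho_i\ge 0$ and $\omega_i\ge 0$ for $i=1,\ldots,m$ satisfy the nondegeneracy condition $\rho_{k-1}+\rho_k+\omega_k>0$ for every $k\in\{1,\ldots,m\}$ (with $\rho_0:=\rho_m$). Assume: (a) for every connected component with hub, at least one of the sets belonging to that component (that is, $\mathcal S$ or one of the $C_j$ in that component) is bounded; (b) for every connected component without hub, at least one of the sets $C_j$ in that component is bounded. Then the Generalized Heron--Waist Problem $$\min_{(a_1,\ldots,a_m,x)\in\Omega} J(a_1,\ldots,a_m,x)$$ admits an optimal solution, i.e. $J$ attains its infimum over $\Omega$.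
   Context: The space $\mathbb R^n$ carries the Euclidean norm $\|\cdot\|$. The feasible set is $\Omega:=C_1\times\cdots\times C_m\times\mathcal S\subset\mathbb R^{n(m+1)}$, and the objective is $$J(a_1,\ldots,a_m,x):=\sum_{i=1}^m\rho_i\|a_i-a_{i+1}\|+\sum_{i=1}^m\omega_i\|a_i-x\|,\qquad a_{m+1}:=a_1.$$ Indices of the $C_i$, $a_i$, $\rho_i$ are interpreted cyclically modulo $m$. General position: for each $i$ let $K_i:=\operatorname{conv}\bigl(C_1\cup\cdots\cup C_{i-1}\cup C_{i+1}\cup\cdots\cup C_m\cup\mathcal S\bigr)$. The collection $\{C_i\}_{i=1}^m$ is in general position with respect to $\mathcal S$ if $C_i\cap K_i=\varnothing$ for all $i=1,\ldots,m$. Connected components: consider the graph whose vertices are the $m+1$ (indexed) sets $C_1,\ldots,C_m,\mathcal S$, where $C_i$ and $C_{i+1}$ are joined (cyclically) whenever $\rho_i>0$, and $C_i$ and $\mathcal S$ are joined whenever $\omega_i>0$. A connected component with hub is the connected component of this graph containing $\mathcal S$, provided it contains at least one $C_k$ with $\omega_k>0$ (if all $\omega_i=0$ there is no connected component with hub). A connected component without hub is a connected component of the graph not containing $\mathcal S$ (so it consists of sets $C_j$ only). *)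

theory Defs
  imports "HOL-Analysis.Analysis"
begin

text \<open>Indices range over \<open>{1..m}\<close> and are read cyclically.\<close>

definition cyc_succ :: "nat \<Rightarrow> nat \<Rightarrow> nat" where
  "cyc_succ m i = (if i = m then 1 else i + 1)"

definition cyc_pred :: "nat \<Rightarrow> nat \<Rightarrow> nat" where
  "cyc_pred m i = (if i = 1 then m else i - 1)"

definition feasible_set ::
  "nat \<Rightarrow> (nat \<Rightarrow> (real ^ 'n) set) \<Rightarrow> (real ^ 'n) set \<Rightarrow> ((nat \<Rightarrow> real ^ 'n) \<times> (real ^ 'n)) set"
  where "feasible_set m C S = (\<Pi>\<^sub>E i\<in>{1..m}. C i) \<times> S"

definition heron_waist_obj ::
  "nat \<Rightarrow> (nat \<Rightarrow> real) \<Rightarrow> (nat \<Rightarrow> real) \<Rightarrow> (nat \<Rightarrow> real ^ 'n) \<times> (real ^ 'n) \<Rightarrow> real"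
  where "heron_waist_obj m \<rho> \<omega> = (\<lambda>(a, x).
    (\<Sum>i=1..m. \<rho> i * norm (a i - a (cyc_succ m i))) + (\<Sum>i=1..m. \<omega> i * norm (a i - x)))"

definition general_position ::
  "nat \<Rightarrow> (nat \<Rightarrow> (real ^ 'n) set) \<Rightarrow> (real ^ 'n) set \<Rightarrow> bool"
  where "general_position m C S \<longleftrightarrow>
    (\<forall>i\<in>{1..m}. C i \<inter> convex hull ((\<Union>j\<in>{1..m} - {i}. C j) \<union> S) = {})"

text \<open>
  The vertices of the graph are indexed sets: \<open>Site i\<close> stands for \<open>C\<^sub>i\<close> and \<open>Hub\<close> for \<open>S\<close>,
  so sets that happen to coincide still give distinct vertices.
\<close>

datatype vertex = Hub | Site nat

primrec vertex_set :: "(nat \<Rightarrow> 'a set) \<Rightarrow> 'a set \<Rightarrow> vertex \<Rightarrow> 'a set" where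
  "vertex_set C S Hub = S"
| "vertex_set C S (Site i) = C i"

definition vertices :: "nat \<Rightarrow> vertex set" where
  "vertices m = insert Hub (Site ` {1..m})"

definition arcs :: "nat \<Rightarrow> (nat \<Rightarrow> real) \<Rightarrow> (nat \<Rightarrow> real) \<Rightarrow> (vertex \<times> vertex) set" where
  "arcs m \<rho> \<omega> =
    {(Site i, Site (cyc_succ m i)) | i. i \<in> {1..m} \<and> \<rho> i > 0} \<union>
    {(Site i, Hub) | i. i \<in> {1..m} \<and> \<omega> i > 0}"

definition adjacency :: "nat \<Rightarrow> (nat \<Rightarrow> real) \<Rightarrow> (nat \<Rightarrow> real) \<Rightarrow> (vertex \<times> vertex) set" where
  "adjacency m \<rho> \<omega> = arcs m \<rho> \<omega> \<union> (arcs m \<rho> \<omega>)\<inverse>"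

definition graph_components :: "nat \<Rightarrow> (nat \<Rightarrow> real) \<Rightarrow> (nat \<Rightarrow> real) \<Rightarrow> vertex set set" where
  "graph_components m \<rho> \<omega> =
    vertices m // {(u, v) \<in> vertices m \<times> vertices m. (u, v) \<in> (adjacency m \<rho> \<omega>)\<^sup>*}"

definition component_with_hub ::
  "nat \<Rightarrow> (nat \<Rightarrow> real) \<Rightarrow> (nat \<Rightarrow> real) \<Rightarrow> vertex set \<Rightarrow> bool" where
  "component_with_hub m \<rho> \<omega> W \<longleftrightarrow>
    W \<in> graph_components m \<rho> \<omega> \<and> Hub \<in> W \<and> (\<exists>k\<in>{1..m}. Site k \<in> W \<and> \<omega> k > 0)"

definition component_without_hub ::
  "nat \<Rightarrow> (nat \<Rightarrow> real) \<Rightarrow> (nat \<Rightarrow> real) \<Rightarrow> vertex set \<Rightarrow> bool" where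
  "component_without_hub m \<rho> \<omega> W \<longleftrightarrow> W \<in> graph_components m \<rho> \<omega> \<and> Hub \<notin> W"

end

theory Submission
  imports Defs
begin

text \<open>
  Existence follows from the direct method, the point being compactness of a sublevel set.
  Write \<open>J\<close> for the objective and consider the feasible points whose value is at most that of a
  chosen feasible point \<open>(a\<^sub>0, x\<^sub>0)\<close>. All terms of \<open>J\<close> are nonnegative, so on this set each single
  term is bounded; dividing by its weight, the two points at the ends of an edge of the graph stay
  at bounded distance from each other. Distances add up along a walk, so the same is true of any two
  vertices of one component (\<open>uniformly_close_along_walk\<close>). Hence boundedness of one coordinate
  spreads to the whole component, and every component contains a coordinate to start from: the
  one that is confined to a bounded set.

  The only component for which the hypotheses provide no bounded set is that of the hub when all
  \<open>\<omega> i\<close> vanish. But then \<open>J\<close> does not depend on \<open>x\<close>, and \<open>x\<close> may be pinned to \<open>x\<^sub>0\<close> without losing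
  any value of \<open>J\<close>. The sublevel set, so restricted, lies in a product of compact
  sets (\<open>normalized_sublevel_bounded\<close>), on which the continuous \<open>J\<close> attains its minimum.
\<close>

section \<open>The objective\<close>

lemma heron_waist_obj_Pair:
  "heron_waist_obj m \<rho> \<omega> (a, x) =
    (\<Sum>i=1..m. \<rho> i * norm (a i - a (cyc_succ m i))) + (\<Sum>i=1..m. \<omega> i * norm (a i - x))"
  by (simp add: heron_waist_obj_def)

lemma continuous_on_heron_waist_obj: "continuous_on K (heron_waist_obj m \<rho> \<omega>)"
proof -
  have coord: "continuous_on K (\<lambda>p. fst p i)"
    for i :: nat and K :: "((nat \<Rightarrow> real ^ 'n) \<times> (real ^ 'n)) set"
    by (rule continuous_on_product_then_coordinatewise) (intro continuous_intros)
  show ?thesis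
    unfolding heron_waist_obj_def case_prod_unfold
    by (intro continuous_intros coord)
qed

lemma heron_waist_obj_hub_irrelevant:
  assumes "\<And>i. i \<in> {1..m} \<Longrightarrow> \<omega> i = 0"
  shows "heron_waist_obj m \<rho> \<omega> (a, x) = heron_waist_obj m \<rho> \<omega> (a, y)"
  using assms by (simp add: heron_waist_obj_Pair)

lemma heron_waist_obj_ge_terms:
  assumes nonneg: "\<And>i. i \<in> {1..m} \<Longrightarrow> \<rho> i \<ge> 0" "\<And>i. i \<in> {1..m} \<Longrightarrow> \<omega> i \<ge> 0"
    and i: "i \<in> {1..m}"
  shows "\<rho> i * norm (a i - a (cyc_succ m i)) \<le> heron_waist_obj m \<rho> \<omega> (a, x)"
    and "\<omega> i * norm (a i - x) \<le> heron_waist_obj m \<rho> \<omega> (a, x)"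
proof -
  let ?R = "\<lambda>i. \<rho> i * norm (a i - a (cyc_succ m i))" and ?O = "\<lambda>i. \<omega> i * norm (a i - x)"
  have "?R i \<le> sum ?R {1..m}" "?O i \<le> sum ?O {1..m}"
    by (intro member_le_sum i; simp add: nonneg)+
  moreover have "sum ?R {1..m} \<ge> 0" "sum ?O {1..m} \<ge> 0"
    by (intro sum_nonneg; simp add: nonneg)+
  ultimately show "?R i \<le> heron_waist_obj m \<rho> \<omega> (a, x)" "?O i \<le> heron_waist_obj m \<rho> \<omega> (a, x)"
    by (simp_all add: heron_waist_obj_Pair)
qed

primrec vertex_point :: "(nat \<Rightarrow> 'a) \<times> 'a \<Rightarrow> vertex \<Rightarrow> 'a" where
  "vertex_point p Hub = snd p"
| "vertex_point p (Site i) = fst p i"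

lemma vertex_point_in_vertex_set:
  assumes "p \<in> feasible_set m C S" "v \<in> vertices m"
  shows "vertex_point p v \<in> vertex_set C S v"
  using assms by (auto simp: feasible_set_def vertices_def)

section \<open>Uniform bounds along the graph\<close>

text \<open>
  Bounds are uniform over \<open>P\<close>: each edge of a walk contributes a constant that serves
  all of \<open>P\<close>, and by the triangle inequality the sum of these constants serves for the endpoints.
\<close>

lemma uniformly_close_along_walk:
  fixes f :: "'p \<Rightarrow> 'v \<Rightarrow> 'a::metric_space"
  assumes "(u, v) \<in> r\<^sup>*"
    and edge: "\<And>u v. (u, v) \<in> r \<Longrightarrow> \<exists>L. \<forall>p\<in>P. dist (f p u) (f p v) \<le> L"
  shows "\<exists>L. \<forall>p\<in>P. dist (f p u) (f p v) \<le> L"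
  using assms(1)
proof (induction rule: rtrancl_induct)
  case base
  show ?case by (intro exI[of _ 0]) simp
next
  case (step y z)
  from step.IH obtain L where L: "\<forall>p\<in>P. dist (f p u) (f p y) \<le> L" by blast
  from edge[OF step.hyps(2)] obtain L' where L': "\<forall>p\<in>P. dist (f p y) (f p z) \<le> L'" by blast
  have "dist (f p u) (f p z) \<le> L + L'" if "p \<in> P" for p
    using dist_triangle[of "f p u" "f p z" "f p y"] L L' that by fastforce
  then show ?case by blast
qed

lemma adjacent_uniformly_close:
  fixes P :: "((nat \<Rightarrow> real ^ 'n) \<times> (real ^ 'n)) set"
  assumes nonneg: "\<And>i. i \<in> {1..m} \<Longrightarrow> \<rho> i \<ge> 0" "\<And>i. i \<in> {1..m} \<Longrightarrow> \<omega> i \<ge> 0"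
    and sub: "\<And>p. p \<in> P \<Longrightarrow> heron_waist_obj m \<rho> \<omega> p \<le> M"
    and uv: "(u, v) \<in> adjacency m \<rho> \<omega>"
  shows "\<exists>L. \<forall>p\<in>P. dist (vertex_point p u) (vertex_point p v) \<le> L"
proof -
  have arc: "\<exists>L. \<forall>p\<in>P. dist (vertex_point p u) (vertex_point p v) \<le> L"
    if "(u, v) \<in> arcs m \<rho> \<omega>" for u v
  proof -
    from that consider
        (side) i where "i \<in> {1..m}" "\<rho> i > 0" "u = Site i" "v = Site (cyc_succ m i)"
      | (spoke) i where "i \<in> {1..m}" "\<omega> i > 0" "u = Site i" "v = Hub"
      by (auto simp: arcs_def)
    then show ?thesis
    proof cases
      case side
      have "dist (vertex_point p u) (vertex_point p v) \<le> M / \<rho> i" if "p \<in> P" for p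
      proof -
        obtain a x where p: "p = (a, x)" by fastforce
        have "\<rho> i * norm (a i - a (cyc_succ m i)) \<le> M"
          using heron_waist_obj_ge_terms(1)[of m \<rho> \<omega> i a x] nonneg side(1) sub[OF that] p
          by fastforce
        then show ?thesis
          using side by (simp add: p dist_norm pos_le_divide_eq mult.commute)
      qed
      then show ?thesis by blast
    next
      case spoke
      have "dist (vertex_point p u) (vertex_point p v) \<le> M / \<omega> i" if "p \<in> P" for p
      proof -
        obtain a x where p: "p = (a, x)" by fastforce
        have "\<omega> i * norm (a i - x) \<le> M"
          using heron_waist_obj_ge_terms(2)[of m \<rho> \<omega> i a x] nonneg spoke(1) sub[OF that] p
          by fastforce
        then show ?thesis
          using spoke by (simp add: p dist_norm pos_le_divide_eq mult.commute)
      qed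
      then show ?thesis by blast
    qed
  qed
  from uv consider "(u, v) \<in> arcs m \<rho> \<omega>" | "(v, u) \<in> arcs m \<rho> \<omega>"
    by (auto simp: adjacency_def)
  then show ?thesis
    by cases (use arc[of u v] arc[of v u] in \<open>auto simp: dist_commute\<close>)
qed

definition component_of :: "nat \<Rightarrow> (nat \<Rightarrow> real) \<Rightarrow> (nat \<Rightarrow> real) \<Rightarrow> vertex \<Rightarrow> vertex set" where
  "component_of m \<rho> \<omega> v = {u \<in> vertices m. (v, u) \<in> (adjacency m \<rho> \<omega>)\<^sup>*}"

lemma component_of_in_graph_components:
  assumes "v \<in> vertices m"
  shows "component_of m \<rho> \<omega> v \<in> graph_components m \<rho> \<omega>"
proof -
  let ?R = "{(u, v) \<in> vertices m \<times> vertices m. (u, v) \<in> (adjacency m \<rho> \<omega>)\<^sup>*}"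
  have "component_of m \<rho> \<omega> v = ?R `` {v}"
    using assms by (auto simp: component_of_def)
  then show ?thesis
    unfolding graph_components_def using quotientI[OF assms, of ?R] by simp
qed

text \<open>
  The anchor of a component is its bounded set. A component that contains the hub but is not a
  component with hub in the technical sense arises only if all \<open>\<omega> i\<close> vanish, because
  any spoke of positive weight puts its site into the component of the hub; the pinned coordinate
  of the hub is then the anchor.
\<close>

lemma normalized_sublevel_bounded:
  fixes C :: "nat \<Rightarrow> (real ^ 'n) set"
  assumes nonneg: "\<And>i. i \<in> {1..m} \<Longrightarrow> \<rho> i \<ge> 0" "\<And>i. i \<in> {1..m} \<Longrightarrow> \<omega> i \<ge> 0"
    and with_hub: "\<And>W. component_with_hub m \<rho> \<omega> W \<Longrightarrow> \<exists>v\<in>W. bounded (vertex_set C S v)"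
    and without_hub: "\<And>W. component_without_hub m \<rho> \<omega> W \<Longrightarrow>
      \<exists>j\<in>{1..m}. Site j \<in> W \<and> bounded (C j)"
    and P: "P \<subseteq> feasible_set m C S" "\<And>p. p \<in> P \<Longrightarrow> heron_waist_obj m \<rho> \<omega> p \<le> M"
    and pinned: "\<And>p. p \<in> P \<Longrightarrow> \<forall>i\<in>{1..m}. \<omega> i = 0 \<Longrightarrow> snd p = pin"
    and v: "v \<in> vertices m"
  shows "\<exists>B. \<forall>p\<in>P. norm (vertex_point p v) \<le> B"
proof -
  let ?W = "component_of m \<rho> \<omega> v"
  have comp: "?W \<in> graph_components m \<rho> \<omega>"
    using v by (rule component_of_in_graph_components)
  have bounded_anchor: "\<exists>B. \<forall>p\<in>P. norm (vertex_point p u) \<le> B"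
    if "u \<in> ?W" "bounded (vertex_set C S u)" for u
  proof -
    from that(2) obtain B where "\<forall>y\<in>vertex_set C S u. norm y \<le> B"
      unfolding bounded_iff by blast
    moreover have "vertex_point p u \<in> vertex_set C S u" if "p \<in> P" for p
      using vertex_point_in_vertex_set[of p m C S u] P(1) that \<open>u \<in> ?W\<close>
      by (auto simp: component_of_def)
    ultimately show ?thesis by blast
  qed
  have "\<exists>u\<in>?W. \<exists>B. \<forall>p\<in>P. norm (vertex_point p u) \<le> B"
  proof (cases "Hub \<in> ?W")
    case False
    then obtain j where "Site j \<in> ?W" "bounded (C j)"
      using without_hub[of ?W] comp by (auto simp: component_without_hub_def)
    then show ?thesis by (metis bounded_anchor vertex_set.simps(2))
  next
    case hub: True
    show ?thesis
    proof (cases "\<exists>k\<in>{1..m}. \<omega> k > 0")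
      case True
      then obtain k where k: "k \<in> {1..m}" "\<omega> k > 0" by blast
      then have "(Hub, Site k) \<in> adjacency m \<rho> \<omega>"
        by (auto simp: adjacency_def arcs_def)
      then have "Site k \<in> ?W"
        using hub k(1) by (auto simp: component_of_def vertices_def intro: rtrancl_into_rtrancl)
      then have "component_with_hub m \<rho> \<omega> ?W"
        unfolding component_with_hub_def using comp hub k by blast
      then obtain u where "u \<in> ?W" "bounded (vertex_set C S u)"
        by (blast dest: with_hub)
      then show ?thesis
        by (intro bexI[of _ u] bounded_anchor)
    next
      case False
      then have "\<forall>i\<in>{1..m}. \<omega> i = 0" using nonneg(2) by (meson linorder_neqE_linordered_idom not_le)
      then have "\<forall>p\<in>P. norm (vertex_point p Hub) \<le> norm pin"
        using pinned by simp
      then show ?thesis using hub by blast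
    qed
  qed
  then obtain u B where u: "u \<in> ?W" and B: "\<forall>p\<in>P. norm (vertex_point p u) \<le> B" by blast
  have "\<exists>L. \<forall>p\<in>P. dist (vertex_point p v) (vertex_point p u) \<le> L"
  proof (rule uniformly_close_along_walk)
    show "(v, u) \<in> (adjacency m \<rho> \<omega>)\<^sup>*"
      using u by (simp add: component_of_def)
    show "\<exists>L. \<forall>p\<in>P. dist (vertex_point p y) (vertex_point p z) \<le> L"
      if "(y, z) \<in> adjacency m \<rho> \<omega>" for y z
      using nonneg P(2) that by (rule adjacent_uniformly_close)
  qed
  then obtain L where L: "\<forall>p\<in>P. dist (vertex_point p v) (vertex_point p u) \<le> L" by blast
  have "norm (vertex_point p v) \<le> B + L" if "p \<in> P" for p
    using norm_triangle_sub[of "vertex_point p v" "vertex_point p u"] B L that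
    by (fastforce simp: dist_norm)
  then show ?thesis by blast
qed

section \<open>Existence of a minimizer\<close>

lemma compact_PiE:
  fixes K :: "'i \<Rightarrow> 'a::topological_space set"
  assumes "\<And>i. i \<in> I \<Longrightarrow> compact (K i)"
  shows "compact (PiE I K)"
proof -
  \<comment> \<open>The topology on functions is that of the product over the whole index type, so the
    coordinates outside \<open>I\<close> enter as factors consisting of the single value \<open>undefined\<close>.\<close>
  have eq: "PiE I K = PiE UNIV (\<lambda>i. if i \<in> I then K i else {undefined})"
    by (auto simp: PiE_iff extensional_def split: if_splits)
  have "compactin (product_topology (\<lambda>i. euclidean) UNIV) (PiE I K)"
    unfolding eq compactin_PiE using assms by simp
  then show ?thesis by (simp add: euclidean_product_topology)
qed

theorem theorem3p2:
  fixes m :: nat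
    and C :: "nat \<Rightarrow> (real ^ 'n) set" and S :: "(real ^ 'n) set"
    and \<rho> \<omega> :: "nat \<Rightarrow> real"
  assumes "m \<ge> 3"
    and "\<And>i. i \<in> {1..m} \<Longrightarrow> C i \<noteq> {} \<and> closed (C i) \<and> convex (C i)"
    and "S \<noteq> {}" and "closed S" and "convex S"
    and "general_position m C S"
    and "\<And>i. i \<in> {1..m} \<Longrightarrow> \<rho> i \<ge> 0"
    and "\<And>i. i \<in> {1..m} \<Longrightarrow> \<omega> i \<ge> 0"
    and "\<And>k. k \<in> {1..m} \<Longrightarrow> \<rho> (cyc_pred m k) + \<rho> k + \<omega> k > 0"
    and "\<And>W. component_with_hub m \<rho> \<omega> W \<Longrightarrow> \<exists>v\<in>W. bounded (vertex_set C S v)"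
    and "\<And>W. component_without_hub m \<rho> \<omega> W \<Longrightarrow> \<exists>j\<in>{1..m}. Site j \<in> W \<and> bounded (C j)"
  shows "\<exists>p\<in>feasible_set m C S. \<forall>q\<in>feasible_set m C S.
           heron_waist_obj m \<rho> \<omega> p \<le> heron_waist_obj m \<rho> \<omega> q"
proof -
  let ?J = "heron_waist_obj m \<rho> \<omega>" and ?\<Omega> = "feasible_set m C S"
  obtain x0 where x0: "x0 \<in> S" using assms(3) by blast
  obtain a0 where a0: "a0 \<in> PiE {1..m} C"
    using assms(2) by (metis PiE_eq_empty_iff ex_in_conv)
  define P where "P = {p \<in> ?\<Omega>. ?J p \<le> ?J (a0, x0) \<and> ((\<forall>i\<in>{1..m}. \<omega> i = 0) \<longrightarrow> snd p = x0)}"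
  have base: "(a0, x0) \<in> P"
    using a0 x0 by (simp add: P_def feasible_set_def)
  have "\<exists>B. \<forall>p\<in>P. norm (vertex_point p v) \<le> B" if "v \<in> vertices m" for v
  proof (rule normalized_sublevel_bounded[OF assms(7,8,10,11) _ _ _ that])
    show "P \<subseteq> ?\<Omega>" by (auto simp: P_def)
    show "?J p \<le> ?J (a0, x0)" if "p \<in> P" for p
      using that by (simp add: P_def)
    show "snd p = x0" if "p \<in> P" "\<forall>i\<in>{1..m}. \<omega> i = 0" for p
      using that by (simp add: P_def)
  qed
  then obtain B where B: "\<And>v p. v \<in> vertices m \<Longrightarrow> p \<in> P \<Longrightarrow> norm (vertex_point p v) \<le> B v"
    by metis
  define K where "K = (\<Pi>\<^sub>E i\<in>{1..m}. C i \<inter> cball 0 (B (Site i))) \<times> (S \<inter> cball 0 (B Hub))"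
  have "compact K"
    unfolding K_def using assms(2,4)
    by (intro compact_Times compact_PiE closed_Int_compact compact_cball) auto
  have "P \<subseteq> K"
  proof
    fix p assume p: "p \<in> P"
    have "norm (fst p i) \<le> B (Site i)" if "i \<in> {1..m}" for i
      using B[OF _ p, of "Site i"] that by (simp add: vertices_def)
    moreover have "norm (snd p) \<le> B Hub"
      using B[OF _ p, of Hub] by (simp add: vertices_def)
    ultimately show "p \<in> K"
      using p by (auto simp: P_def K_def feasible_set_def PiE_iff)
  qed
  have "K \<subseteq> ?\<Omega>" by (auto simp: K_def feasible_set_def PiE_iff)
  obtain p where p: "p \<in> K" "\<forall>q\<in>K. ?J p \<le> ?J q"
    using continuous_attains_inf[OF \<open>compact K\<close> _ continuous_on_heron_waist_obj] base \<open>P \<subseteq> K\<close>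
    by blast
  have "?J p \<le> ?J q" if q: "q \<in> ?\<Omega>" for q
  proof (cases "?J q \<le> ?J (a0, x0)")
    case True
    obtain a x where ax: "q = (a, x)" by fastforce
    \<comment> \<open>The competitor enters \<open>P\<close>, at no change of value, once its hub point is pinned if need be.\<close>
    define q' where "q' = (if \<forall>i\<in>{1..m}. \<omega> i = 0 then (a, x0) else q)"
    have "?J q' = ?J q"
      using heron_waist_obj_hub_irrelevant[of m \<omega> \<rho> a x0 x] by (simp add: q'_def ax)
    moreover have "q' \<in> P"
      using q x0 True \<open>?J q' = ?J q\<close> by (auto simp: P_def q'_def ax feasible_set_def)
    ultimately show ?thesis using p(2) \<open>P \<subseteq> K\<close> by force
  next
    case False
    then show ?thesis using p(2) base \<open>P \<subseteq> K\<close> by force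
  qed
  then show ?thesis using p(1) \<open>K \<subseteq> ?\<Omega>\<close> by blast
qed

end
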